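(* Let $\mathbb{F}_q$ be the finite field with $q$ elements, let $\mathcal{H}=\mathcal{H}(m,n,\mathcal{X},f)$ be the side information hypergraph of an instance $(m,n,\mathcal{X},f)$ of the index coding with side information (ICSI) problem, and let $\delta\ge 0$ be an integer. The length $\mathcal{N}_q(\mathcal{H},\delta)$ of an optimal linear $\delta$-error-correcting index code ($(\delta,\mathcal{H})$-ECIC) over $\mathbb{F}_q$ satisfies $$\mathcal{N}_q(\mathcal{H},\delta)\ \ge\ \kappa_q(\mathcal{H})+2\delta,$$ where $\kappa_q(\mathcal{H})$ is the min-rank of $\mathcal{H}$ over $\mathbb{F}_q$.
   Context: Notation: $[n]=\{1,\dots,n\}$; $\mathsf{wt}$ denotes Hamming weight; for $\boldsymbol{x}\in\mathbb{F}_q^n$ and $B\subseteq[n]$, $\boldsymbol{x}_B$ is the subvector of $\boldsymbol{x}$ indexed by $B$; $\boldsymbol{e}_j\in\mathbb{F}_q^n$ is the $j$th unit vector. Vectors are row vectors. ICSI instance: integers $m,n\ge 1$, subsets $\mathcal{X}_i\subseteq[n]$ for $i\in[m]$ with $\mathcal{X}=(\mathcal{X}_1,\dots,\mathcal{X}_m)$, and a map $f:[m]\to[n]$ with $f(i)\notin\mathcal{X}_i$ for all $i$. (Receiver $R_i$ knows $\boldsymbol{x}_{\mathcal{X}_i}$ and wants $x_{f(i)}$.) The side information hypergraph $\mathcal{H}(m,n,\mathcal{X},f)$ is the directed hypergraph with vertex set $[n]$ and edges $(f(i),\mathcal{X}_i)$, $i\in[m]$; it represents the instance. ECIC: a $\delta$-error-correcting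 index code ($(\delta,\mathcal{H})$-ECIC) over $\mathbb{F}_q$ of length $N$ is a map $\mathfrak{E}:\mathbb{F}_q^n\to\mathbb{F}_q^N$ such that for each $i\in[m]$ there is a map $\mathfrak{D}_i:\mathbb{F}_q^N\times\mathbb{F}_q^{|\mathcal{X}_i|}\to\mathbb{F}_q$ with $\mathfrak{D}_i(\mathfrak{E}(\boldsymbol{x})+\boldsymbol{\epsilon}_i,\boldsymbol{x}_{\mathcal{X}_i})=x_{f(i)}$ for all $\boldsymbol{x}\in\mathbb{F}_q^n$ and all $\boldsymbol{\epsilon}_i\in\mathbb{F}_q^N$ with $\mathsf{wt}(\boldsymbol{\epsilon}_i)\le\delta$. It is linear if $\mathfrak{E}(\boldsymbol{x})=\boldsymbol{x}\boldsymbol{L}$ for some $n\times N$ matrix $\boldsymbol{L}$ over $\mathbb{F}_q$. $\mathcal{N}_q(\mathcal{H},\delta)$ is the smallest length of a linear $(\delta,\mathcal{H})$-ECIC over $\mathbb{F}_q$; a linear code attaining it is called optimal. Min-rank: $\kappa_q(\mathcal{H})=\min\{\mathrm{rank}_{\mathbb{F}_q}(\{\boldsymbol{v}_i+\boldsymbol{e}_{f(i)}\}_{i\in[m]}) : \boldsymbol{v}_i\in\mathbb{F}_q^n,\ \mathrm{supp}(\boldsymbol{v}_i)\subseteq\mathcal{X}_i\text{ for all } i\in[m]\}$, where the rank of a family of vectors is the dimension of its span and $\mathrm{supp}(\boldsymbol{v})$ is the set of positions of nonzero entries. *)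

theory Defs
  imports "Jordan_Normal_Form.DL_Rank"
begin

text \<open>
  The field with \<open>q\<close> elements is a type \<open>'a :: {finite,field}\<close> with \<open>q = CARD('a)\<close>.
  Indices are those of \<open>'a vec\<close>, i.e. \<open>[n]\<close> is \<open>{..<n}\<close>. The hypergraph
  \<open>H(m,n,X,f)\<close> is passed around as its data \<open>m n X f\<close>; only
  the values of \<open>X\<close> and \<open>f\<close> on \<open>{..<m}\<close> matter.
\<close>

definition icsi_instance :: "nat \<Rightarrow> nat \<Rightarrow> (nat \<Rightarrow> nat set) \<Rightarrow> (nat \<Rightarrow> nat) \<Rightarrow> bool" where
  "icsi_instance m n X f \<longleftrightarrow> 1 \<le> m \<and> 1 \<le> n \<and>
     (\<forall>i<m. X i \<subseteq> {..<n} \<and> f i < n \<and> f i \<notin> X i)"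

definition supp :: "'a::zero vec \<Rightarrow> nat set" where
  "supp v = {j. j < dim_vec v \<and> v $ j \<noteq> 0}"

definition wt :: "'a::zero vec \<Rightarrow> nat" where
  "wt v = card (supp v)"

definition subvec :: "'a vec \<Rightarrow> nat set \<Rightarrow> 'a vec" where
  "subvec x B = vec_of_list (nths (list_of_vec x) B)"

text \<open>
  Decoders are total functions on \<open>'a vec\<close>; only their values at arguments of
  dimensions \<open>N\<close> and \<open>card (X i)\<close> are constrained.
\<close>

definition is_ecic ::
  "nat \<Rightarrow> nat \<Rightarrow> nat \<Rightarrow> (nat \<Rightarrow> nat set) \<Rightarrow> (nat \<Rightarrow> nat) \<Rightarrow> nat
    \<Rightarrow> ('a::{finite,field} vec \<Rightarrow> 'a vec) \<Rightarrow> bool" where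
  "is_ecic \<delta> m n X f N E \<longleftrightarrow>
     (\<forall>x \<in> carrier_vec n. E x \<in> carrier_vec N) \<and>
     (\<forall>i<m. \<exists>D :: 'a vec \<Rightarrow> 'a vec \<Rightarrow> 'a.
        \<forall>x \<in> carrier_vec n. \<forall>\<epsilon> \<in> carrier_vec N.
          wt \<epsilon> \<le> \<delta> \<longrightarrow> D (E x + \<epsilon>) (subvec x (X i)) = x $ f i)"

text \<open>
  The row vector \<open>xL\<close> is \<open>L\<^sup>T *\<^sub>v x\<close>, since \<open>'a vec\<close> does not distinguish
  rows from columns.
\<close>

definition is_linear_encoder ::
  "nat \<Rightarrow> nat \<Rightarrow> ('a::{finite,field} vec \<Rightarrow> 'a vec) \<Rightarrow> bool" where
  "is_linear_encoder n N E \<longleftrightarrow>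
     (\<exists>L \<in> carrier_mat n N. \<forall>x \<in> carrier_vec n. E x = transpose_mat L *\<^sub>v x)"

text \<open>
  The minimum exists: repeating every symbol \<open>2 * \<delta> + 1\<close> times is a linear
  \<open>\<delta>\<close>-error-correcting index code for every instance.
\<close>

definition optimal_length ::
  "'a::{finite,field} itself \<Rightarrow> nat \<Rightarrow> nat \<Rightarrow> (nat \<Rightarrow> nat set) \<Rightarrow> (nat \<Rightarrow> nat) \<Rightarrow> nat \<Rightarrow> nat" where
  "optimal_length _ m n X f \<delta> =
     (LEAST N. \<exists>E :: 'a vec \<Rightarrow> 'a vec. is_linear_encoder n N E \<and> is_ecic \<delta> m n X f N E)"

definition (in vec_space) family_rank :: "nat \<Rightarrow> (nat \<Rightarrow> 'a vec) \<Rightarrow> nat" where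
  "family_rank m u = vectorspace.dim class_ring (span_vs (u ` {..<m}))"

definition min_rank ::
  "'a::{finite,field} itself \<Rightarrow> nat \<Rightarrow> nat \<Rightarrow> (nat \<Rightarrow> nat set) \<Rightarrow> (nat \<Rightarrow> nat) \<Rightarrow> nat" where
  "min_rank _ m n X f =
     (LEAST k. \<exists>v :: nat \<Rightarrow> 'a vec.
        (\<forall>i<m. v i \<in> carrier_vec n \<and> supp (v i) \<subseteq> X i) \<and>
        k = vec_space.family_rank n m (\<lambda>i. v i + unit_vec n (f i)))"

end

(* Let an optimal linear code x \<mapsto> xL of length N be given. If z vanishes on X i but not at
   f i, then zL has weight more than 2\<delta>, since otherwise z and 0 could be confused; so deleting
   the first 2\<delta> columns of L leaves a matrix A with zA \<noteq> 0 for every such z. By linear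
   duality, e_(f i) agrees outside X i with some A y_i, so the A y_i form a family admissible
   in the definition of the min-rank, and it spans a space of dimension at most N - 2\<delta>. *)
theory Submission
  imports Defs
begin

section \<open>Linear algebra: duality for linear systems and a dimension bound\<close>

text \<open>This is the Fredholm alternative, with rows in \<open>J\<close> and columns in
  \<open>K\<close>: either \<open>u\<close> is a combination of the columns, or some functional
  \<open>z\<close> kills all columns but not \<open>u\<close>. The induction adds one column
  \<open>p\<close> at a time and asks whether some functional that kills the earlier columns detects
  the new one.\<close>

lemma linear_alternative:
  fixes a :: "'i \<Rightarrow> 'k \<Rightarrow> 'a::field"
  assumes "finite J" "finite K"
  shows "(\<exists>y. \<forall>j\<in>J. (\<Sum>k\<in>K. a j k * y k) = u j) \<or>
         (\<exists>z. (\<forall>k\<in>K. (\<Sum>j\<in>J. z j * a j k) = 0) \<and> (\<Sum>j\<in>J. z j * u j) \<noteq> 0)"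
  using assms(2)
proof (induction K arbitrary: u rule: finite_induct)
  case empty
  show ?case
  proof (cases "\<forall>j\<in>J. u j = 0")
    case False
    then obtain l where l: "l \<in> J" "u l \<noteq> 0" by blast
    have "(\<Sum>j\<in>J. (if j = l then 1 else 0) * u j) = u l"
      using l(1) assms(1) by (simp add: if_distrib[of "\<lambda>t. t * _"] cong: if_cong)
    with l(2) show ?thesis by (intro disjI2 exI[of _ "\<lambda>j. if j = l then 1 else 0"]) simp
  qed simp
next
  case (insert p K)
  let ?dot = "\<lambda>z v. \<Sum>j\<in>J. z j * v j"
  let ?w = "\<lambda>j. a j p"
  have lift: "\<exists>y. \<forall>j\<in>J. (\<Sum>k\<in>insert p K. a j k * y k) = u j"
    if y: "\<forall>j\<in>J. (\<Sum>k\<in>K. a j k * y k) = u j - c * a j p" for y c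
  proof (intro exI[of _ "y(p := c)"] ballI)
    fix j assume j: "j \<in> J"
    have "(\<Sum>k\<in>K. a j k * (y(p := c)) k) = (\<Sum>k\<in>K. a j k * y k)"
      using insert.hyps(2) by (intro sum.cong) auto
    then show "(\<Sum>k\<in>insert p K. a j k * (y(p := c)) k) = u j"
      using insert.hyps y j by (simp add: algebra_simps)
  qed
  show ?case
  proof (cases "\<exists>z. (\<forall>k\<in>K. ?dot z (\<lambda>j. a j k) = 0) \<and> ?dot z ?w \<noteq> 0")
    case True
    then obtain z0 where z0: "\<forall>k\<in>K. ?dot z0 (\<lambda>j. a j k) = 0" "?dot z0 ?w \<noteq> 0" by blast
    \<comment> \<open>The coefficient of column \<open>p\<close> is forced: \<open>z0\<close> kills
      the columns in \<open>K\<close>, so pairing the system with \<open>z0\<close> leaves only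
      \<open>c\<close> times the pairing of \<open>z0\<close> with column \<open>p\<close>.\<close>
    define c where "c = ?dot z0 u / ?dot z0 ?w"
    consider y where "\<forall>j\<in>J. (\<Sum>k\<in>K. a j k * y k) = u j - c * a j p"
      | z1 where "\<forall>k\<in>K. ?dot z1 (\<lambda>j. a j k) = 0" "?dot z1 (\<lambda>j. u j - c * a j p) \<noteq> 0"
      using insert.IH[of "\<lambda>j. u j - c * a j p"] by blast
    then show ?thesis
    proof cases
      case 1
      from lift[OF this] show ?thesis ..
    next
      case 2
      \<comment> \<open>\<open>d\<close> is chosen so that \<open>z\<close> kills column
        \<open>p\<close> as well. The pairing of \<open>z\<close> with \<open>u\<close> then equals
        that of \<open>z1\<close> with \<open>u\<close> minus \<open>c\<close> times column
        \<open>p\<close>, which is nonzero.\<close>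
      define d where "d = ?dot z1 ?w / ?dot z0 ?w"
      define z where "z = (\<lambda>j. z1 j - d * z0 j)"
      have dot_z: "?dot z v = ?dot z1 v - d * ?dot z0 v" for v
        by (simp add: z_def algebra_simps sum_subtractf sum_distrib_left)
      have "?dot z1 (\<lambda>j. u j - c * a j p) = ?dot z1 u - c * ?dot z1 ?w"
        by (simp add: algebra_simps sum_subtractf sum_distrib_left)
      also have "c * ?dot z1 ?w = d * ?dot z0 u"
        by (simp add: c_def d_def)
      finally have "?dot z u \<noteq> 0" using 2(2) by (simp add: dot_z)
      moreover have "?dot z ?w = 0" using z0(2) by (simp add: dot_z d_def)
      moreover have "\<forall>k\<in>K. ?dot z (\<lambda>j. a j k) = 0"
        using z0(1) 2(1) by (simp add: dot_z)
      ultimately show ?thesis by (intro disjI2 exI[of _ z]) simp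
    qed
  next
    case False
    \<comment> \<open>Whatever kills the columns in \<open>K\<close> also kills column
      \<open>p\<close>. So a solution extends by the coefficient 0, and a functional from the
      induction hypothesis still serves.\<close>
    consider y where "\<forall>j\<in>J. (\<Sum>k\<in>K. a j k * y k) = u j - 0 * a j p"
      | z where "\<forall>k\<in>K. ?dot z (\<lambda>j. a j k) = 0" "?dot z u \<noteq> 0"
      using insert.IH[of u] by auto
    then show ?thesis
    proof cases
      case 1
      from lift[OF this] show ?thesis ..
    next
      case 2
      with False show ?thesis by (intro disjI2 exI[of _ z]) auto
    qed
  qed
qed

text \<open>A maximal independent subset \<open>T\<close> of \<open>U\<close> has as many elements
  as the dimension of the span of \<open>U\<close>, and Steinitz exchange
  (\<open>replacement\<close>) bounds \<open>card T\<close> by \<open>card B\<close>.\<close>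

lemma (in vec_space) dim_span_le_card:
  assumes "finite U" "finite B" "B \<subseteq> carrier_vec n" "U \<subseteq> span B"
  shows "vectorspace.dim class_ring (span_vs U) \<le> card B"
proof -
  have U: "U \<subseteq> carrier_vec n" using assms(3,4) span_is_subset2 by auto
  obtain T where T: "finite T" "maximal T (\<lambda>T. T \<subseteq> U \<and> lin_indpt T)"
    using maximal_exists_superset[of U "\<lambda>T. T \<subseteq> U \<and> lin_indpt T" "{}"] assms(1)
    by (auto simp: finite_lin_indpt2)
  then have "T \<subseteq> span B" "lin_indpt T" using assms(4) by (auto simp: maximal_def)
  from replacement[OF T(1) assms(2) _ this(2,1)] assms(3)
  have "card T \<le> card B" by fastforce
  then show ?thesis using dim_span[OF _ assms(1) T(2)] U by simp
qed

section \<open>Side information, weights and confusable messages\<close>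

lemma subvec_cong:
  assumes "dim_vec x = dim_vec y" "\<And>j. j \<in> B \<Longrightarrow> j < dim_vec x \<Longrightarrow> x $ j = y $ j"
  shows "subvec x B = subvec y B"
proof -
  \<comment> \<open>Selection becomes a map over a list of positions that depends only on the
    dimension and on \<open>B\<close>.\<close>
  have *: "nths (list_of_vec v) B = map (($) v) (nths [0..<dim_vec v] B)" for v :: "'a vec"
  proof -
    have "list_of_vec v = map (($) v) [0..<dim_vec v]"
      by (rule nth_equalityI) (auto simp: list_of_vec_index)
    then show ?thesis by (simp add: nths_map)
  qed
  show ?thesis
    unfolding subvec_def * assms(1)
    using assms by (intro arg_cong[where f = vec_of_list] map_cong) (auto simp: set_nths)
qed

lemma wt_le_card:
  assumes "finite B" "supp v \<subseteq> B"
  shows "wt v \<le> card B"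
  using assms by (simp add: wt_def card_mono)

text \<open>A decoder is a function: two transmissions that give receiver \<open>i\<close> the same
  word and the same side information must get the same answer.\<close>

lemma is_ecicD:
  assumes "is_ecic \<delta> m n X f N E" "i < m" "x \<in> carrier_vec n" "x' \<in> carrier_vec n"
    and "\<epsilon> \<in> carrier_vec N" "\<epsilon>' \<in> carrier_vec N" "wt \<epsilon> \<le> \<delta>" "wt \<epsilon>' \<le> \<delta>"
    and "\<And>j. j \<in> X i \<Longrightarrow> j < n \<Longrightarrow> x $ j = x' $ j" "E x + \<epsilon> = E x' + \<epsilon>'"
  shows "x $ f i = x' $ f i"
proof -
  obtain D where D: "\<And>x \<epsilon>. x \<in> carrier_vec n \<Longrightarrow> \<epsilon> \<in> carrier_vec N \<Longrightarrow> wt \<epsilon> \<le> \<delta> \<Longrightarrow>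
      D (E x + \<epsilon>) (subvec x (X i)) = x $ f i"
    using assms(1,2) unfolding is_ecic_def by metis
  have "subvec x (X i) = subvec x' (X i)"
    using assms by (intro subvec_cong) auto
  then show ?thesis using D[of x \<epsilon>] D[of x' \<epsilon>'] assms by simp
qed


section \<open>Deleting 2\<delta> columns, and the length bound\<close>

lemma linear_encoder_index:
  fixes L :: "'a::field mat"
  assumes "L \<in> carrier_mat n N" "x \<in> carrier_vec n" "k < N"
  shows "(transpose_mat L *\<^sub>v x) $ k = (\<Sum>j<n. x $ j * L $$ (j, k))"
  using assms by (auto simp: scalar_prod_def lessThan_atLeast0 mult.commute intro!: sum.cong)

text \<open>This is the contrapositive of zA \<noteq> 0, with \<open>ker\<close> saying that zA = 0.
  It also covers N \<le> 2\<delta>, where no column is left; N < 2\<delta> is ruled out later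
  through this case.\<close>

lemma ecic_punctured_nonzero:
  fixes E :: "'a::{finite,field} vec \<Rightarrow> 'a vec"
  assumes ecic: "is_ecic \<delta> m n X f N E" and "i < m"
    and L: "L \<in> carrier_mat n N" and E: "\<forall>x \<in> carrier_vec n. E x = transpose_mat L *\<^sub>v x"
    and z: "z \<in> carrier_vec n" "\<And>j. j \<in> X i \<Longrightarrow> j < n \<Longrightarrow> z $ j = 0"
    and ker: "\<And>k. k \<in> {2 * \<delta>..<N} \<Longrightarrow> (\<Sum>j<n. z $ j * L $$ (j, k)) = 0"
    and "f i < n"
  shows "z $ f i = 0"
proof -
  \<comment> \<open>The at most \<open>2 * \<delta>\<close> nonzero entries of \<open>E z\<close> are split evenly between two error vectors.\<close>
  define \<epsilon> where "\<epsilon> = vec N (\<lambda>k. if k < \<delta> then - (E z $ k) else 0)"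
  define \<epsilon>' where "\<epsilon>' = vec N (\<lambda>k. if k \<in> {\<delta>..<2 * \<delta>} then E z $ k else 0)"
  have "wt \<epsilon> \<le> card {..<\<delta>}"
    by (rule wt_le_card) (auto simp: \<epsilon>_def supp_def split: if_splits)
  moreover have "wt \<epsilon>' \<le> card {\<delta>..<2 * \<delta>}"
    by (rule wt_le_card) (auto simp: \<epsilon>'_def supp_def split: if_splits)
  moreover have "E z + \<epsilon> = E (0\<^sub>v n) + \<epsilon>'"
  proof (rule eq_vecI)
    fix k assume "k < dim_vec (E (0\<^sub>v n) + \<epsilon>')"
    then have k: "k < N" by (simp add: \<epsilon>'_def)
    have Ek: "E x $ k = (\<Sum>j<n. x $ j * L $$ (j, k))" if "x \<in> carrier_vec n" for x
      using that E linear_encoder_index[OF L _ k] by simp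
    have "E (0\<^sub>v n) $ k = 0" by (simp add: Ek)
    moreover have "E z $ k = 0" if "2 * \<delta> \<le> k" using ker[of k] that k z by (simp add: Ek)
    ultimately show "(E z + \<epsilon>) $ k = (E (0\<^sub>v n) + \<epsilon>') $ k"
      using k by (auto simp: \<epsilon>_def \<epsilon>'_def)
  qed (simp add: \<epsilon>_def \<epsilon>'_def)
  ultimately have "z $ f i = 0\<^sub>v n $ f i"
    using z by (intro is_ecicD[OF ecic \<open>i < m\<close>, of _ _ \<epsilon> \<epsilon>']) (auto simp: \<epsilon>_def \<epsilon>'_def)
  then show ?thesis using \<open>f i < n\<close> by simp
qed

text \<open>Only the rows outside \<open>X i\<close> are prescribed, since the min-rank leaves the
  entries in \<open>X i\<close> free. The dual obstruction to a solution would be a \<open>z\<close>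
  that \<open>ecic_punctured_nonzero\<close> excludes.\<close>

lemma punctured_columns_represent:
  fixes E :: "'a::{finite,field} vec \<Rightarrow> 'a vec"
  assumes ecic: "is_ecic \<delta> m n X f N E" and "i < m"
    and L: "L \<in> carrier_mat n N" and E: "\<forall>x \<in> carrier_vec n. E x = transpose_mat L *\<^sub>v x"
    and fi: "f i < n" "f i \<notin> X i"
  shows "\<exists>y. \<forall>j\<in>{..<n} - X i. (\<Sum>k\<in>{2 * \<delta>..<N}. L $$ (j, k) * y k) = unit_vec n (f i) $ j"
proof (rule ccontr)
  assume contra: "\<not> ?thesis"
  let ?J = "{..<n} - X i"
  obtain z where z: "\<And>k. k \<in> {2 * \<delta>..<N} \<Longrightarrow> (\<Sum>j\<in>?J. z j * L $$ (j, k)) = 0"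
      "(\<Sum>j\<in>?J. z j * unit_vec n (f i) $ j) \<noteq> 0"
    using linear_alternative[of ?J "{2 * \<delta>..<N}" "\<lambda>j k. L $$ (j, k)" "\<lambda>j. unit_vec n (f i) $ j"]
      contra by blast
  \<comment> \<open>Extension by zero makes the side information of \<open>z'\<close> vanish and
    leaves the pairings with the columns unchanged.\<close>
  define z' where "z' = vec n (\<lambda>j. if j \<in> X i then 0 else z j)"
  have "(\<Sum>j<n. z' $ j * L $$ (j, k)) = (\<Sum>j\<in>?J. z j * L $$ (j, k))" for k
    by (rule sum.mono_neutral_cong_right) (auto simp: z'_def)
  then have "z' $ f i = 0"
    using z(1) by (intro ecic_punctured_nonzero[OF ecic \<open>i < m\<close> L E]) (auto simp: z'_def fi)
  then have "z (f i) = 0" using fi by (simp add: z'_def)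
  then have "(\<Sum>j\<in>?J. z j * unit_vec n (f i) $ j) = 0"
    by (intro sum.neutral) (auto simp: unit_vec_def)
  with z(2) show False by contradiction
qed

lemma linear_ecic_length_ge:
  fixes E :: "'a::{finite,field} vec \<Rightarrow> 'a vec"
  assumes icsi: "icsi_instance m n X f"
    and lin: "is_linear_encoder n N E" and ecic: "is_ecic \<delta> m n X f N E"
  shows "min_rank TYPE('a) m n X f + 2 * \<delta> \<le> N"
proof -
  interpret vec_space "TYPE('a)" n .
  obtain L where L: "L \<in> carrier_mat n N" "\<forall>x \<in> carrier_vec n. E x = transpose_mat L *\<^sub>v x"
    using lin by (auto simp: is_linear_encoder_def)
  have f: "f i < n" "f i \<notin> X i" if "i < m" for i
    using icsi that by (auto simp: icsi_instance_def)
  have "\<forall>i\<in>{..<m}. \<exists>y. \<forall>j\<in>{..<n} - X i.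
      (\<Sum>k\<in>{2 * \<delta>..<N}. L $$ (j, k) * y k) = unit_vec n (f i) $ j"
    using punctured_columns_represent[OF ecic _ L f] by blast
  from bchoice[OF this]
  obtain y where y: "\<And>i j. i < m \<Longrightarrow> j < n \<Longrightarrow> j \<notin> X i \<Longrightarrow>
      (\<Sum>k\<in>{2 * \<delta>..<N}. L $$ (j, k) * y i k) = unit_vec n (f i) $ j"
    by auto
  have "0 < m" using icsi by (simp add: icsi_instance_def)
  \<comment> \<open>If N < 2\<delta>, the sum for receiver 0 is empty and its equation at
    \<open>f 0\<close> reads 0 = 1. From here on the subtraction in \<open>N - 2 * \<delta>\<close>
    is exact.\<close>
  have "2 * \<delta> \<le> N"
  proof (rule ccontr)
    assume "\<not> 2 * \<delta> \<le> N"
    then show False using y[OF \<open>0 < m\<close> f[OF \<open>0 < m\<close>]] f[OF \<open>0 < m\<close>] by simp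
  qed
  define A where "A = mat n (N - 2 * \<delta>) (\<lambda>(j, k). L $$ (j, k + 2 * \<delta>))"
  define g where "g i = A *\<^sub>v vec (N - 2 * \<delta>) (\<lambda>k. y i (k + 2 * \<delta>))" for i
  \<comment> \<open>\<open>v i\<close> vanishes outside \<open>X i\<close> because
    \<open>g i\<close> agrees with the unit vector there; adding that vector back recovers
    \<open>g i\<close>, which lies in the column space of \<open>A\<close>.\<close>
  define v where "v i = g i - unit_vec n (f i)" for i
  have A: "A \<in> carrier_mat n (N - 2 * \<delta>)" by (simp add: A_def)
  have g_carrier: "g i \<in> carrier_vec n" for i by (simp add: g_def A_def carrier_vecI)
  have g_index: "g i $ j = unit_vec n (f i) $ j" if "i < m" "j < n" "j \<notin> X i" for i j
  proof -
    have "g i $ j = (\<Sum>k\<in>{0..<N - 2 * \<delta>}. L $$ (j, k + 2 * \<delta>) * y i (k + 2 * \<delta>))"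
      using that by (auto simp: g_def A_def scalar_prod_def intro!: sum.cong)
    also have "\<dots> = (\<Sum>k\<in>{0 + 2 * \<delta>..<N - 2 * \<delta> + 2 * \<delta>}. L $$ (j, k) * y i k)"
      by (simp only: sum.shift_bounds_nat_ivl)
    also have "\<dots> = unit_vec n (f i) $ j" using y that \<open>2 * \<delta> \<le> N\<close> by simp
    finally show ?thesis .
  qed
  have "v i \<in> carrier_vec n \<and> supp (v i) \<subseteq> X i" if "i < m" for i
    using g_index[OF that] g_carrier[of i] by (fastforce simp: v_def supp_def)
  then have "min_rank TYPE('a) m n X f \<le> family_rank m (\<lambda>i. v i + unit_vec n (f i))"
    unfolding min_rank_def by (intro Least_le) auto
  also have "(\<lambda>i. v i + unit_vec n (f i)) = g"
  proof
    show "v i + unit_vec n (f i) = g i" for i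
      using g_carrier[of i] by (intro eq_vecI) (auto simp: v_def)
  qed
  also have "family_rank m g \<le> card (set (cols A))"
    unfolding family_rank_def
  proof (rule dim_span_le_card)
    show "set (cols A) \<subseteq> carrier_vec n" using cols_dim[of A] A by simp
    show "g ` {..<m} \<subseteq> span (set (cols A))"
      using col_space_eq[OF A] A by (auto simp: col_space_def g_def)
  qed auto
  \<comment> \<open>Repeated columns of \<open>A\<close> coincide in the set, hence an
    inequality.\<close>
  also have "\<dots> \<le> N - 2 * \<delta>" using card_length[of "cols A"] A by simp
  finally show ?thesis using \<open>2 * \<delta> \<le> N\<close> by simp
qed

section \<open>Existence of a linear code: the repetition code\<close>

text \<open>The decoder picks any message consistent with the received word and the side
  information, which is what \<open>P\<close> expresses. All consistent messages agree at
  \<open>f i\<close>, so the choice does not affect the answer.\<close>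

lemma is_ecicI:
  fixes E :: "'a::{finite,field} vec \<Rightarrow> 'a vec"
  assumes "\<And>x. x \<in> carrier_vec n \<Longrightarrow> E x \<in> carrier_vec N"
    and "\<And>i x x' \<epsilon> \<epsilon>'. i < m \<Longrightarrow> x \<in> carrier_vec n \<Longrightarrow> x' \<in> carrier_vec n \<Longrightarrow>
      \<epsilon> \<in> carrier_vec N \<Longrightarrow> \<epsilon>' \<in> carrier_vec N \<Longrightarrow> wt \<epsilon> \<le> \<delta> \<Longrightarrow> wt \<epsilon>' \<le> \<delta> \<Longrightarrow>
      E x + \<epsilon> = E x' + \<epsilon>' \<Longrightarrow> subvec x (X i) = subvec x' (X i) \<Longrightarrow> x $ f i = x' $ f i"
  shows "is_ecic \<delta> m n X f N E"
proof -
  have "\<exists>D. \<forall>x \<in> carrier_vec n. \<forall>\<epsilon> \<in> carrier_vec N.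
          wt \<epsilon> \<le> \<delta> \<longrightarrow> D (E x + \<epsilon>) (subvec x (X i)) = x $ f i" if "i < m" for i
  proof -
    define P where "P w s x \<longleftrightarrow> x \<in> carrier_vec n \<and>
      (\<exists>\<epsilon> \<in> carrier_vec N. wt \<epsilon> \<le> \<delta> \<and> w = E x + \<epsilon> \<and> s = subvec x (X i))" for w s x
    have unique: "x' $ f i = x $ f i"
      if P: "P (E x + \<epsilon>) (subvec x (X i)) x'" and x: "x \<in> carrier_vec n"
        and \<epsilon>: "\<epsilon> \<in> carrier_vec N" "wt \<epsilon> \<le> \<delta>" for x x' \<epsilon>
    proof -
      obtain \<epsilon>' where "x' \<in> carrier_vec n" "\<epsilon>' \<in> carrier_vec N" "wt \<epsilon>' \<le> \<delta>"
          "E x + \<epsilon> = E x' + \<epsilon>'" "subvec x (X i) = subvec x' (X i)"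
        using P by (auto simp: P_def)
      from assms(2)[OF \<open>i < m\<close> x this(1) \<epsilon>(1) this(2) \<epsilon>(2) this(3-5)]
      show ?thesis by simp
    qed
    have "(SOME x'. P (E x + \<epsilon>) (subvec x (X i)) x') $ f i = x $ f i"
      if "x \<in> carrier_vec n" "\<epsilon> \<in> carrier_vec N" "wt \<epsilon> \<le> \<delta>" for x \<epsilon>
    proof -
      have "P (E x + \<epsilon>) (subvec x (X i)) x" using that by (auto simp: P_def)
      then have "P (E x + \<epsilon>) (subvec x (X i)) (SOME x'. P (E x + \<epsilon>) (subvec x (X i)) x')"
        by (rule someI)
      then show ?thesis using that by (rule unique)
    qed
    then show ?thesis
      by (intro exI[of _ "\<lambda>w s. (SOME x. P w s x) $ f i"]) blast
  qed
  with assms(1) show ?thesis unfolding is_ecic_def by blast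
qed

text \<open>Messages that differ at \<open>f i\<close> differ throughout a block of 2\<delta> + 1
  positions. Equal received words would need an error at each of these, but two errors of weight at
  most \<delta> reach only 2\<delta>.\<close>

lemma repetition_code_is_ecic:
  fixes n \<delta> :: nat and X :: "nat \<Rightarrow> nat set"
  assumes f: "\<And>i. i < m \<Longrightarrow> f i < n"
  defines "N \<equiv> n * (2 * \<delta> + 1)"
  defines "L \<equiv> mat n N (\<lambda>(j, k). if k div (2 * \<delta> + 1) = j then 1 else 0) :: 'a::{finite,field} mat"
  shows "is_ecic \<delta> m n X f N (\<lambda>x. transpose_mat L *\<^sub>v x)"
proof (rule is_ecicI)
  have L: "L \<in> carrier_mat n N" by (simp add: L_def)
  show "transpose_mat L *\<^sub>v x \<in> carrier_vec N" for x
    using L by (simp add: carrier_vecI)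
  fix i and x x' \<epsilon> \<epsilon>' :: "'a vec"
  assume i: "i < m" and x: "x \<in> carrier_vec n" "x' \<in> carrier_vec n"
    and \<epsilon>: "\<epsilon> \<in> carrier_vec N" "\<epsilon>' \<in> carrier_vec N" "wt \<epsilon> \<le> \<delta>" "wt \<epsilon>' \<le> \<delta>"
    and eq: "transpose_mat L *\<^sub>v x + \<epsilon> = transpose_mat L *\<^sub>v x' + \<epsilon>'"
  show "x $ f i = x' $ f i"
  proof (rule ccontr)
    assume ne: "x $ f i \<noteq> x' $ f i"
    let ?q = "2 * \<delta> + 1"
    let ?B = "{f i * ?q..<f i * ?q + ?q}"
    have "k \<in> supp \<epsilon> \<union> supp \<epsilon>'" if k: "k \<in> ?B" for k
    proof -
      have div: "k div ?q = f i"
        by (rule div_nat_eqI) (use k in \<open>auto simp: algebra_simps\<close>)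
      \<comment> \<open>\<open>Suc (f i) * ?q\<close> is the first position after the block, so the
        whole block lies below \<open>N\<close>.\<close>
      have "Suc (f i) * ?q \<le> n * ?q" using f[OF i] by (intro mult_right_mono) auto
      then have kN: "k < N" using k unfolding N_def by simp
      have rep: "(transpose_mat L *\<^sub>v w) $ k = w $ f i" if "w \<in> carrier_vec n" for w
      proof -
        have "(transpose_mat L *\<^sub>v w) $ k = (\<Sum>j<n. w $ j * L $$ (j, k))"
          by (rule linear_encoder_index[OF L that kN])
        also have "\<dots> = (\<Sum>j<n. if j = f i then w $ j else 0)"
          using kN div by (intro sum.cong) (auto simp: L_def)
        also have "\<dots> = w $ f i" using f[OF i] by simp
        finally show ?thesis .
      qed
      have "(transpose_mat L *\<^sub>v x + \<epsilon>) $ k = (transpose_mat L *\<^sub>v x' + \<epsilon>') $ k"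
        by (simp only: eq)
      then have "x $ f i + \<epsilon> $ k = x' $ f i + \<epsilon>' $ k"
        using \<epsilon> kN rep x by simp
      then have "\<epsilon> $ k \<noteq> 0 \<or> \<epsilon>' $ k \<noteq> 0" using ne by auto
      then show ?thesis using \<epsilon> kN by (auto simp: supp_def)
    qed
    then have "?B \<subseteq> supp \<epsilon> \<union> supp \<epsilon>'" by blast
    then have "card ?B \<le> card (supp \<epsilon> \<union> supp \<epsilon>')"
      by (rule card_mono[rotated]) (simp add: supp_def)
    also have "\<dots> \<le> wt \<epsilon> + wt \<epsilon>'" unfolding wt_def by (rule card_Un_le)
    finally show False using \<epsilon> by simp
  qed
qed

theorem mainTheorem3:
  fixes m n \<delta> :: nat and X :: "nat \<Rightarrow> nat set" and f :: "nat \<Rightarrow> nat"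
  assumes "icsi_instance m n X f"
  shows "optimal_length TYPE('a::{finite,field}) m n X f \<delta>
           \<ge> min_rank TYPE('a) m n X f + 2 * \<delta>"
proof -
  let ?P = "\<lambda>N. \<exists>E :: 'a vec \<Rightarrow> 'a vec. is_linear_encoder n N E \<and> is_ecic \<delta> m n X f N E"
  have "is_linear_encoder n N (\<lambda>x. transpose_mat L *\<^sub>v x)" if "L \<in> carrier_mat n N"
    for N and L :: "'a mat"
    using that by (auto simp: is_linear_encoder_def)
  moreover have "\<And>i. i < m \<Longrightarrow> f i < n" using assms by (simp add: icsi_instance_def)
  note repetition_code_is_ecic[of m f n \<delta> X, OF this]
  ultimately have "?P (n * (2 * \<delta> + 1))" by (meson mat_carrier)
  \<comment> \<open>The repetition code makes the set of admissible lengths nonempty, so the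
    \<open>LEAST\<close> is attained by an actual code, to which the bound applies.\<close>
  then have "?P (LEAST N. ?P N)" by (rule LeastI)
  then show ?thesis
    unfolding optimal_length_def using linear_ecic_length_ge[OF assms] by blast
qed

end
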